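(* Let $k$ be a field, let $D$ be a division $k$-algebra, let $\sigma\colon D\to D$ be a $k$-automorphism and let $\delta\colon D\to D$ be a $\sigma$-derivation. Let $a_0,a_1,b_0,b_1\in k$ with $a_1\neq 0$, let $f=a_0+a_1X$ and $g=b_0+b_1X$ in $k[X]\subseteq D[X;\sigma,\delta]$, and assume that $\Xi=gf^{-1}\in D(X;\sigma,\delta)\setminus k$. Let $\psi\colon D\to D$ be the map $\psi=a_1\delta+a_0(\mathrm{Id}-\sigma)$, where $\mathrm{Id}$ is the identity map of $D$, and let $E=\ker\psi$. Let $\alpha\in D$ be such that \begin{itemize} \item $\{1,\alpha,\alpha^2\}$ is left linearly independent over $\sigma(E)$, and \item $\psi(D)\cap\bigl(\sigma(E)+\sigma(E)\alpha+\sigma(E)\alpha^2\bigr)=\{0\}$. \end{itemize} If either (i) $b_1=0$, or (ii) $b_0=0$ and $\delta=0$, then the set $\{\alpha\Xi,\Xi\alpha\}$ freely generates a free (associative, unital) $k$-subalgebra in $D(X;\sigma,\delta)$.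
   Context: A $\sigma$-derivation of $D$ is a $k$-linear map $\delta\colon D\to D$ satisfying $\delta(\alpha\beta)=\sigma(\alpha)\delta(\beta)+\delta(\alpha)\beta$ for all $\alpha,\beta\in D$. $D[X;\sigma,\delta]$ denotes the skew polynomial ring in the indeterminate $X$, with coefficients written on the left, such that $X\alpha=\sigma(\alpha)X+\delta(\alpha)$ for all $\alpha\in D$, and $D(X;\sigma,\delta)$ denotes its (Ore) division ring of fractions. The map $\psi$ is again a $\sigma$-derivation. *)

theory Defs
  imports "HOL-Library.Poly_Mapping" "HOL-Computational_Algebra.Polynomial"
begin

locale k_algebra = vector_space scale
  for scale :: "'k::field \<Rightarrow> 'a::ring_1 \<Rightarrow> 'a" +
  assumes scale_mult_left: "scale c x * y = scale c (x * y)"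
    and scale_mult_right: "x * scale c y = scale c (x * y)"

definition k_automorphism :: "('k::field \<Rightarrow> 'a::ring_1 \<Rightarrow> 'a) \<Rightarrow> ('a \<Rightarrow> 'a) \<Rightarrow> bool" where
  "k_automorphism scale \<sigma> \<longleftrightarrow>
     Vector_Spaces.linear scale scale \<sigma> \<and> bij \<sigma> \<and> \<sigma> 1 = 1 \<and> (\<forall>x y. \<sigma> (x * y) = \<sigma> x * \<sigma> y)"

definition skew_derivation ::
    "('k::field \<Rightarrow> 'a::ring_1 \<Rightarrow> 'a) \<Rightarrow> ('a \<Rightarrow> 'a) \<Rightarrow> ('a \<Rightarrow> 'a) \<Rightarrow> bool" where
  "skew_derivation scale \<sigma> \<delta> \<longleftrightarrow>
     Vector_Spaces.linear scale scale \<delta> \<and> (\<forall>x y. \<delta> (x * y) = \<sigma> x * \<delta> y + \<delta> x * y)"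

text \<open>
  The elements of \<open>D[X;\<sigma>,\<delta>]\<close> are represented by \<^typ>\<open>'d poly\<close>, the coefficients being
  written on the left of the powers of \<open>X\<close>. Only the additive structure of \<^typ>\<open>'d poly\<close> is
  used; its multiplication is replaced by the one determined by \<open>X a = \<sigma>(a) X + \<delta>(a)\<close>.
  Left multiplication by \<open>X\<close> therefore sends \<open>\<Sum> a\<^sub>i X\<^sup>i\<close> to \<open>\<Sum> \<sigma>(a\<^sub>i) X\<^sup>i\<^sup>+\<^sup>1 + \<Sum> \<delta>(a\<^sub>i) X\<^sup>i\<close>.
\<close>

definition skew_X_times :: "('d::ring_1 \<Rightarrow> 'd) \<Rightarrow> ('d \<Rightarrow> 'd) \<Rightarrow> 'd poly \<Rightarrow> 'd poly" where
  "skew_X_times \<sigma> \<delta> q = pCons 0 (map_poly \<sigma> q) + map_poly \<delta> q"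

definition skew_times :: "('d::ring_1 \<Rightarrow> 'd) \<Rightarrow> ('d \<Rightarrow> 'd) \<Rightarrow> 'd poly \<Rightarrow> 'd poly \<Rightarrow> 'd poly" where
  "skew_times \<sigma> \<delta> p q =
     (\<Sum>i\<le>degree p. map_poly (\<lambda>b. coeff p i * b) ((skew_X_times \<sigma> \<delta> ^^ i) q))"

lemma skew_times_X_const:
  assumes "\<sigma> 0 = 0" and "\<delta> 0 = 0"
  shows "skew_times \<sigma> \<delta> [:0, 1:] [:a:] = [:\<delta> a, \<sigma> a:]"
  using assms
  by (intro poly_eqI)
     (auto simp: skew_times_def skew_X_times_def coeff_map_poly coeff_pCons split: nat.split)

lemma skew_times_const:
  "skew_times \<sigma> \<delta> [:a:] q = map_poly (\<lambda>b. a * b) q"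
  by (simp add: skew_times_def)

text \<open>
  An Ore division ring of fractions of \<open>D[X;\<sigma>,\<delta>]\<close> is a division ring into which \<open>D[X;\<sigma>,\<delta>]\<close>
  embeds so that every element is a fraction \<open>p s\<^sup>-\<^sup>1\<close> with \<open>s \<noteq> 0\<close>. For an automorphism \<open>\<sigma>\<close> of
  a division ring \<open>D\<close> it exists and is unique up to a unique isomorphism over \<open>D[X;\<sigma>,\<delta>]\<close>.
\<close>

definition ore_fractions ::
    "('d::division_ring \<Rightarrow> 'd) \<Rightarrow> ('d \<Rightarrow> 'd) \<Rightarrow> ('d poly \<Rightarrow> 'q::division_ring) \<Rightarrow> bool" where
  "ore_fractions \<sigma> \<delta> \<iota> \<longleftrightarrow>
     inj \<iota> \<and> \<iota> [:1:] = 1 \<and>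
     (\<forall>p q. \<iota> (p + q) = \<iota> p + \<iota> q) \<and>
     (\<forall>p q. \<iota> (skew_times \<sigma> \<delta> p q) = \<iota> p * \<iota> q) \<and>
     (\<forall>z. \<exists>p s. s \<noteq> 0 \<and> z = \<iota> p * inverse (\<iota> s))"

text \<open>
  The independence of a finite family rather than of its set of values: a family with
  repetitions is dependent.
\<close>

definition left_independent :: "'a::ring_1 set \<Rightarrow> 'i set \<Rightarrow> ('i \<Rightarrow> 'a) \<Rightarrow> bool" where
  "left_independent F I v \<longleftrightarrow>
     (\<forall>c. (\<forall>i\<in>I. c i \<in> F) \<and> (\<Sum>i\<in>I. c i * v i) = 0 \<longrightarrow> (\<forall>i\<in>I. c i = 0))"

text \<open>
  The free monoid on \<^typ>\<open>'g\<close>. The type \<open>'g word \<Rightarrow>\<^sub>0 'k\<close> of finitely supported functions is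
  its monoid algebra, with the convolution product of \<^theory>\<open>HOL-Library.Poly_Mapping\<close>; that
  theory wants the monoid to be written additively.
\<close>

datatype 'g word = Word (letters: "'g list")

instantiation word :: (type) monoid_add
begin

definition zero_word :: "'a word" where "0 = Word []"

definition plus_word :: "'a word \<Rightarrow> 'a word \<Rightarrow> 'a word" where
  "u + v = Word (letters u @ letters v)"

instance
  by standard (auto simp: zero_word_def plus_word_def)

end

definition free_algebra :: "'g set \<Rightarrow> ('g word \<Rightarrow>\<^sub>0 'k::field) set" where
  "free_algebra S = {p. \<forall>w\<in>Poly_Mapping.keys p. set (letters w) \<subseteq> S}"

text \<open>
  The canonical homomorphism of \<open>k\<close>-algebras sending each generator, taken to be an element of
  the algebra itself, to that element.
\<close>

definition free_algebra_eval ::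
    "('k::field \<Rightarrow> 'a::ring_1 \<Rightarrow> 'a) \<Rightarrow> ('a word \<Rightarrow>\<^sub>0 'k) \<Rightarrow> 'a" where
  "free_algebra_eval scale p =
     (\<Sum>w\<in>Poly_Mapping.keys p. scale (Poly_Mapping.lookup p w) (prod_list (letters w)))"

text \<open>
  The image of \<^term>\<open>free_algebra S\<close> under the canonical homomorphism is the unital subalgebra
  generated by \<open>S\<close>; it is free on \<open>S\<close> when the homomorphism is injective.
\<close>

definition freely_generates :: "('k::field \<Rightarrow> 'a::ring_1 \<Rightarrow> 'a) \<Rightarrow> 'a set \<Rightarrow> bool" where
  "freely_generates scale S \<longleftrightarrow> inj_on (free_algebra_eval scale) (free_algebra S)"

end

theory Submission
  imports Defs
begin

text \<open>
  Put \<open>F = \<Xi>\<^sup>-\<^sup>1\<close>. It satisfies a rule \<open>F a = \<sigma>(a) F + \<psi>(a)\<close>, where \<open>\<psi>\<close> has, up to a scalar, the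
  kernel and the range of the given map. Consider a left \<open>D\<close>-linear relation, modulo polynomials,
  among the words \<open>F\<^sup>-\<^sup>1 \<alpha>^d\<^sub>1 \<dots> F\<^sup>-\<^sup>1 \<alpha>^d\<^sub>n\<close> with \<open>n \<ge> 1\<close> and all \<open>d\<^sub>i \<le> 2\<close>, having the smallest
  maximal length \<open>n\<close>, then the fewest words of length \<open>n\<close>, and with one leading coefficient equal
  to \<open>1\<close>. Left multiplication by \<open>F\<close> replaces the leading coefficients \<open>c\<^sub>w\<close> by \<open>\<psi>(c\<^sub>w)\<close>, and so kills
  one of them; by minimality the new relation is trivial. Hence the leading \<open>c\<^sub>w\<close> lie in \<open>E = ker \<psi>\<close>, and
  for each word \<open>u\<close> of length \<open>n - 1\<close> the coefficient
  \<open>\<psi>(c\<^sub>u) + \<sigma>(c\<^sub>0\<^sub>u) + \<sigma>(c\<^sub>1\<^sub>u) \<alpha> + \<sigma>(c\<^sub>2\<^sub>u) \<alpha>\<^sup>2\<close> vanishes. The two hypotheses on \<open>\<alpha>\<close> force all the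
  \<open>c\<^sub>i\<^sub>u\<close> to be \<open>0\<close>, against the normalization. The products of \<open>\<alpha> \<Xi>\<close> and \<open>\<Xi> \<alpha>\<close> are such words up to a
  factor \<open>1\<close> or \<open>\<alpha>\<close> on the left.
\<close>

section \<open>Independence of the words in the inverse of a skew variable\<close>

text \<open>
  The set \<open>P\<close> is an abstraction of the polynomials in \<open>F\<close>; the last assumption says that none of them
  is an inverse of \<open>F\<close> up to a coefficient.
\<close>

locale skew_inverse =
  fixes h :: "'d::division_ring \<Rightarrow> 'q::division_ring"
    and \<sigma> \<psi> :: "'d \<Rightarrow> 'd"
    and F :: 'q
    and P :: "'q set"
    and \<alpha> :: 'd
  assumes h_add: "h (x + y) = h x + h y"
    and h_mult: "h (x * y) = h x * h y"
    and h_one: "h 1 = 1"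
    and \<sigma>_one: "\<sigma> 1 = 1"
    and \<psi>_one: "\<psi> 1 = 0"
    and \<psi>_diff: "\<psi> (x - y) = \<psi> x - \<psi> y"
    and F_h: "F * h x = h (\<sigma> x) * F + h (\<psi> x)"
    and F_nonzero: "F \<noteq> 0"
    and independent: "left_independent (\<sigma> ` {x. \<psi> x = 0}) {0, 1, 2 :: nat} (\<lambda>i. \<alpha> ^ i)"
    and \<psi>_disjoint: "(\<And>i. i \<in> {0, 1, 2 :: nat} \<Longrightarrow> c i \<in> \<sigma> ` {x. \<psi> x = 0}) \<Longrightarrow>
      \<psi> x = (\<Sum>i\<in>{0, 1, 2 :: nat}. c i * \<alpha> ^ i) \<Longrightarrow> \<psi> x = 0"
    and h_in_P: "h x \<in> P"
    and P_add: "p \<in> P \<Longrightarrow> q \<in> P \<Longrightarrow> p + q \<in> P"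
    and P_h_mult: "q \<in> P \<Longrightarrow> h x * q \<in> P"
    and P_F_mult: "q \<in> P \<Longrightarrow> F * q \<in> P"
    and P_no_inverse: "q \<in> P \<Longrightarrow> F * q = h x \<Longrightarrow> x = 0"
begin

lemma h_zero: "h 0 = 0"
  using h_add[of 0 0] by simp

lemma h_minus: "h (- x) = - h x"
  using h_add[of x "- x"] by (simp add: h_zero eq_neg_iff_add_eq_0 add.commute)

lemma h_diff: "h (x - y) = h x - h y"
  using h_add[of x "- y"] by (simp add: h_minus)

lemma h_sum: "h (\<Sum>i\<in>I. g i) = (\<Sum>i\<in>I. h (g i))"
  by (induction I rule: infinite_finite_induct) (auto simp: h_zero h_add)

lemma \<psi>_zero: "\<psi> 0 = 0"
  using \<psi>_diff[of 0 0] by simp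

lemma \<psi>_minus: "\<psi> (- x) = - \<psi> x"
  using \<psi>_diff[of 0 x] by (simp add: \<psi>_zero)

lemma P_minus: "q \<in> P \<Longrightarrow> - q \<in> P"
  using P_h_mult[of q "- 1"] by (simp add: h_minus h_one)

text \<open>For \<open>\<alpha> = 0\<close> the coefficients 0, 1, 0 give a dependence. They are
  admissible once \<open>\<sigma> 0 = 0\<close>, which is read off from the commutation rule at
  0.\<close>

lemma \<alpha>_nonzero: "\<alpha> \<noteq> 0"
proof
  assume "\<alpha> = 0"
  have \<sigma>_zero: "\<sigma> 0 = 0"
  proof (rule ccontr)
    assume "\<sigma> 0 \<noteq> 0"
    have "h (\<sigma> 0) * F = 0"
      using F_h[of 0] by (simp add: h_zero \<psi>_zero)
    with F_nonzero have "h (\<sigma> 0) = 0" by simp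
    with \<open>\<sigma> 0 \<noteq> 0\<close> show False
      using h_mult[of "\<sigma> 0" "inverse (\<sigma> 0)"] by (simp add: h_one)
  qed
  have mem: "(of_bool (i = 1) :: 'd) \<in> \<sigma> ` {x. \<psi> x = 0}" for i :: nat
    using \<sigma>_one \<sigma>_zero \<psi>_one \<psi>_zero by (cases "i = 1") (force simp: image_iff)+
  have "(\<Sum>i\<in>{0, 1, 2 :: nat}. of_bool (i = 1) * \<alpha> ^ i) = 0"
    using \<open>\<alpha> = 0\<close> by simp
  with independent mem have "\<forall>i\<in>{0, 1, 2 :: nat}. (of_bool (i = 1) :: 'd) = 0"
    unfolding left_independent_def by (elim allE[where x = "\<lambda>i. of_bool (i = 1)"]) (elim impE; blast)
  then show False by simp
qed

section \<open>Words in the inverse of \<open>F\<close> and left multiplication by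
  \<open>F\<close>\<close>

fun monomial :: "nat list \<Rightarrow> 'q" where
  "monomial [] = 1"
| "monomial (d # u) = inverse F * h (\<alpha> ^ d) * monomial u"

lemma F_monomial_Cons: "F * monomial (d # u) = h (\<alpha> ^ d) * monomial u"
  using F_nonzero by (simp add: mult.assoc[symmetric])

definition words :: "nat \<Rightarrow> nat list set" where
  "words n = {u. set u \<subseteq> {0, 1, 2} \<and> length u \<le> n}"

lemma finite_words: "finite (words n)"
  unfolding words_def by (rule finite_lists_length_le) simp

lemma words_Suc: "words (Suc n) - {[]} = (\<lambda>(d, u). d # u) ` ({0, 1, 2} \<times> words n)"
proof (intro equalityI subsetI)
  fix u assume "u \<in> words (Suc n) - {[]}"
  then show "u \<in> (\<lambda>(d, u). d # u) ` ({0, 1, 2} \<times> words n)"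
    by (cases u) (auto simp: words_def)
qed (auto simp: words_def)

text \<open>The empty word is left out: its multiples are coefficients and lie in
  \<open>P\<close>.\<close>

definition combination :: "nat \<Rightarrow> (nat list \<Rightarrow> 'd) \<Rightarrow> 'q" where
  "combination n c = (\<Sum>u\<in>words n - {[]}. h (c u) * monomial u)"

lemma h_mult_combination: "h x * combination n c = combination n (\<lambda>u. x * c u)"
  by (simp add: combination_def sum_distrib_left h_mult mult.assoc)

definition shifted :: "(nat list \<Rightarrow> 'd) \<Rightarrow> nat list \<Rightarrow> 'd" where
  "shifted c u = (\<Sum>d\<in>{0, 1, 2}. \<sigma> (c (d # u)) * \<alpha> ^ d)"

text \<open>The coefficient of a nonempty \<open>u\<close> after multiplication by \<open>F\<close>.
  The length bound is there because \<open>c\<close> is arbitrary on words longer than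
  \<open>Suc n\<close>, which do not occur in the combination.\<close>

definition step :: "nat \<Rightarrow> (nat list \<Rightarrow> 'd) \<Rightarrow> nat list \<Rightarrow> 'd" where
  "step n c u = \<psi> (c u) + (if length u \<le> n then shifted c u else 0)"

text \<open>Moving \<open>F\<close> past a coefficient applies \<open>\<sigma>\<close>, and
  \<open>F\<close> then cancels the first inverse of the word; the remaining term applies
  \<open>\<psi>\<close> and keeps the word. The shortened words are collected by their common tail,
  and the empty tail yields the separate constant.\<close>

lemma F_mult_combination:
  "F * combination (Suc n) c = h (shifted c []) + combination (Suc n) (step n c)"
proof -
  let ?W = "words (Suc n) - {[]}"
  have "F * combination (Suc n) c =
      (\<Sum>u\<in>?W. h (\<psi> (c u)) * monomial u) + (\<Sum>u\<in>?W. h (\<sigma> (c u)) * (F * monomial u))"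
    by (simp add: combination_def sum_distrib_left mult.assoc[symmetric] F_h
        distrib_right sum.distrib add.commute)
  also have "(\<Sum>u\<in>?W. h (\<sigma> (c u)) * (F * monomial u)) =
      (\<Sum>(d, u)\<in>{0, 1, 2} \<times> words n. h (\<sigma> (c (d # u)) * \<alpha> ^ d) * monomial u)"
    unfolding words_Suc
    by (subst sum.reindex)
      (auto simp: inj_on_def F_monomial_Cons h_mult mult.assoc simp del: monomial.simps intro!: sum.cong)
  also have "\<dots> = (\<Sum>u\<in>words n. h (shifted c u) * monomial u)"
    by (subst sum.cartesian_product[symmetric], subst sum.swap)
      (simp add: shifted_def h_sum h_add distrib_right)
  also have "\<dots> = h (shifted c []) + (\<Sum>u\<in>words n - {[]}. h (shifted c u) * monomial u)"
    by (subst sum.remove[of _ "[]"]) (simp_all add: finite_words, simp add: words_def)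
  also have "(\<Sum>u\<in>words n - {[]}. h (shifted c u) * monomial u) =
      (\<Sum>u\<in>?W. h (if length u \<le> n then shifted c u else 0) * monomial u)"
    by (rule sum.mono_neutral_cong_left) (auto simp: finite_words, auto simp: words_def h_zero)
  finally show ?thesis
    by (simp add: combination_def step_def h_add distrib_right sum.distrib add_ac)
qed

text \<open>The sum \<open>shifted c u\<close> equals \<open>\<psi> (- x)\<close> and has its
  coefficients in the image of the kernel: disjointness makes it zero, and independence then makes
  each coefficient zero.\<close>

lemma shifted_zero_imp:
  assumes "\<And>d. d \<in> {0, 1, 2} \<Longrightarrow> \<psi> (c (d # u)) = 0"
    and "\<psi> x + shifted c u = 0" and "d \<in> {0, 1, 2}"
  shows "\<sigma> (c (d # u)) = 0"
proof -
  have mem: "\<sigma> (c (i # u)) \<in> \<sigma> ` {x. \<psi> x = 0}" if "i \<in> {0, 1, 2}" for i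
    using assms(1)[OF that] by blast
  have "\<psi> (- x) = (\<Sum>i\<in>{0, 1, 2}. \<sigma> (c (i # u)) * \<alpha> ^ i)"
    using assms(2) by (simp add: \<psi>_minus shifted_def neg_eq_iff_add_eq_0)
  from \<psi>_disjoint[OF mem this] this have "(\<Sum>i\<in>{0, 1, 2}. \<sigma> (c (i # u)) * \<alpha> ^ i) = 0"
    by metis
  with mem have "\<forall>i\<in>{0, 1, 2}. \<sigma> (c (i # u)) = 0"
    by (intro independent[unfolded left_independent_def, rule_format, THEN ballI]) auto
  with assms(3) show ?thesis by blast
qed

text \<open>Minimality is expressed by a nested induction: on the length bound \<open>n\<close>,
  then on the number of words of maximal length with nonzero coefficient.\<close>

lemma combination_zero:
  "combination n c \<in> P \<Longrightarrow> u \<in> words n - {[]} \<Longrightarrow> c u = 0"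
proof (induction n arbitrary: c u)
  case 0
  then show ?case by (auto simp: words_def)
next
  case (Suc n)
  define top where "top c = {u \<in> words (Suc n). length u = Suc n \<and> c u \<noteq> 0}" for c :: "nat list \<Rightarrow> 'd"
  have fin: "finite (top c)" for c
    by (simp add: top_def finite_words)
  have "\<forall>u \<in> words (Suc n) - {[]}. c u = 0" if "combination (Suc n) c \<in> P" for c
    using that
  proof (induction "card (top c)" arbitrary: c rule: less_induct)
    case less
    show ?case
    proof (cases "top c = {}")
      case True
      then have top0: "c u = 0" if "u \<in> words (Suc n)" "u \<notin> words n" for u
        using that by (force simp: top_def words_def)
      have "combination (Suc n) c = combination n c"
        unfolding combination_def
        proof (rule sum.mono_neutral_right)
          show "\<forall>u\<in>words (Suc n) - {[]} - (words n - {[]}). h (c u) * monomial u = 0"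
            using top0 h_zero by fastforce
        qed (auto simp: finite_words, auto simp: words_def)
      with less.prems Suc.IH top0 show ?thesis by auto
    next
      case False
      then obtain u0 where u0: "u0 \<in> words (Suc n)" "length u0 = Suc n" "c u0 \<noteq> 0"
        by (auto simp: top_def)
      then obtain d v where dv: "u0 = d # v" "d \<in> {0, 1, 2}" "v \<in> words n" "length v = n"
        by (cases u0) (auto simp: words_def)
      \<comment> \<open>Normalization puts 1 at \<open>u0\<close>, a value that
        \<open>\<psi>\<close> kills.\<close>
      define c' where "c' u = inverse (c u0) * c u" for u
      have c'P: "combination (Suc n) c' \<in> P"
        using P_h_mult[OF less.prems, of "inverse (c u0)"] by (simp add: h_mult_combination c'_def[abs_def])
      have c'_u0: "c' u0 = 1"
        using u0 by (simp add: c'_def)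
      have stepP: "combination (Suc n) (step n c') \<in> P"
        using P_add[OF P_minus[OF h_in_P[of "shifted c' []"]] P_F_mult[OF c'P]]
        by (simp add: F_mult_combination)
      \<comment> \<open>On words of length \<open>Suc n\<close> a step only applies
        \<open>\<psi>\<close>: zeros stay zero and the 1 at \<open>u0\<close> vanishes.\<close>
      have "top (step n c') \<subset> top c"
      proof
        show "top (step n c') \<subseteq> top c"
          by (auto simp: top_def step_def c'_def \<psi>_zero)
        have "u0 \<in> top c - top (step n c')"
          using u0 by (auto simp: top_def step_def c'_u0 \<psi>_one)
        then show "top (step n c') \<noteq> top c" by blast
      qed
      then have "card (top (step n c')) < card (top c)"
        by (simp add: psubset_card_mono fin)
      from less.hyps[OF this stepP] have step0: "step n c' u = 0" if "u \<in> words (Suc n) - {[]}" for u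
        using that by blast
      have ker: "\<psi> (c' (i # v)) = 0" if "i \<in> {0, 1, 2}" for i
        using step0[of "i # v"] dv that by (auto simp: step_def words_def)
      \<comment> \<open>For \<open>v = []\<close> the constant \<open>shifted c' []\<close> is not
        part of the new combination; it vanishes by \<open>P_no_inverse\<close>, so
        \<open>x = 0\<close> serves. Otherwise \<open>x = c' v\<close>.\<close>
      have "\<exists>x. \<psi> x + shifted c' v = 0"
      proof (cases "v = []")
        case True
        have "combination (Suc n) (step n c') = 0"
          unfolding combination_def by (intro sum.neutral) (simp add: step0 h_zero)
        then have "F * combination (Suc n) c' = h (shifted c' [])"
          by (simp add: F_mult_combination)
        with P_no_inverse[OF c'P] True \<psi>_zero show ?thesis by fastforce
      next
        case False
        with step0[of v] dv show ?thesis by (auto simp: step_def words_def)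
      qed
      with shifted_zero_imp[of c' v _ d, OF ker] dv have "\<sigma> (c' (d # v)) = 0" by blast
      with c'_u0 dv \<sigma>_one show ?thesis by simp
    qed
  qed
  with Suc.prems show ?case by blast
qed

lemma monomials_independent:
  assumes "finite U" and "U \<subseteq> lists {0, 1, 2} - {[]}"
    and "(\<Sum>u\<in>U. h (c u) * monomial u) \<in> P" and "u \<in> U"
  shows "c u = 0"
proof -
  define n where "n = Max (length ` U)"
  have sub: "U \<subseteq> words n - {[]}"
    using assms(1,2) by (auto simp: words_def n_def)
  have "combination n (\<lambda>u. if u \<in> U then c u else 0) = (\<Sum>u\<in>U. h (c u) * monomial u)"
    unfolding combination_def
    using sub by (intro sum.mono_neutral_cong_right) (auto simp: finite_words h_zero)
  with combination_zero[of n "\<lambda>u. if u \<in> U then c u else 0" u] assms sub show ?thesis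
    by auto
qed

section \<open>Products of the two generators\<close>

abbreviation generator :: "bool \<Rightarrow> 'q" where
  "generator b \<equiv> (if b then h \<alpha> * inverse F else inverse F * h \<alpha>)"

text \<open>
  Moving the powers of \<open>\<alpha>\<close> together, a product of generators becomes
  \<open>\<alpha>^e F\<^sup>-\<^sup>1 \<alpha>^d\<^sub>1 F\<^sup>-\<^sup>1 \<alpha>^d\<^sub>2 \<dots>\<close> with all \<open>d\<^sub>i \<le> 2\<close>; read from the right, the exponents
  \<open>d\<^sub>i\<close> determine the product, so that the left factor \<open>\<alpha>^e\<close> can be absorbed into the coefficient.
\<close>

fun head_exponent :: "bool list \<Rightarrow> nat" where
  "head_exponent [] = 0"
| "head_exponent (b # bs) = of_bool b"

fun exponents :: "bool list \<Rightarrow> nat list" where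
  "exponents [] = []"
| "exponents (b # bs) = (of_bool (\<not> b) + head_exponent bs) # exponents bs"

lemma head_exponent_le: "head_exponent bs \<le> 1"
  by (cases bs) auto

lemma exponents_in_lists: "exponents bs \<in> lists {0, 1, 2}"
proof (induction bs)
  case (Cons b bs)
  have "of_bool (\<not> b) + head_exponent bs \<le> 2"
    using head_exponent_le[of bs] by simp
  then have "of_bool (\<not> b) + head_exponent bs \<in> {0, 1, 2}"
    by (simp only: insert_iff) linarith
  with Cons show ?case
    by (simp only: exponents.simps lists.intros)
qed simp

lemma inj_exponents: "inj exponents"
proof (rule injI)
  show "bs = cs" if "exponents bs = exponents cs" for bs cs
    using that
  proof (induction bs arbitrary: cs)
    case Nil
    then show ?case by (cases cs) auto
  next
    case (Cons b bs)
    then obtain c cs' where cs: "cs = c # cs'" by (cases cs) auto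
    \<comment> \<open>The tails are recovered first; their head exponents then agree, and the first
      exponent determines the letter.\<close>
    with Cons have "bs = cs'" by auto
    with Cons.prems cs show ?case by (auto simp: of_bool_def split: if_splits)
  qed
qed

text \<open>The power of \<open>\<alpha>\<close> that begins the tail moves into the exponent after
  the new inverse of \<open>F\<close>; a letter \<open>True\<close> leaves its own
  \<open>\<alpha>\<close> in front.\<close>

lemma prod_list_generator:
  "prod_list (map generator bs) = h (\<alpha> ^ head_exponent bs) * monomial (exponents bs)"
proof (induction bs)
  case (Cons b bs)
  then show ?case
    by (cases b) (simp_all add: h_one h_mult mult.assoc)
qed (simp add: h_one)

lemma generators_independent:
  assumes fin: "finite K"
    and zero: "(\<Sum>bs\<in>K. h (c bs) * prod_list (map generator bs)) = 0"
    and mem: "bs \<in> K"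
  shows "c bs = 0"
proof -
  \<comment> \<open>Injectivity of \<open>exponents\<close> allows indexing by exponent lists; the
    left power of \<open>\<alpha>\<close> joins the coefficient and is cancelled at the end by
    \<open>\<alpha>_nonzero\<close>.\<close>
  define c' where "c' u = (let bs = inv exponents u in c bs * \<alpha> ^ head_exponent bs)" for u
  have c': "c' (exponents bs) = c bs * \<alpha> ^ head_exponent bs" for bs
    by (simp add: c'_def inv_f_f[OF inj_exponents])
  have inj: "inj_on exponents A" for A
    using inj_exponents by (rule inj_on_subset) simp
  have summand: "h (c bs) * prod_list (map generator bs) = h (c' (exponents bs)) * monomial (exponents bs)" for bs
    by (simp only: prod_list_generator c' h_mult mult.assoc)
  have eq0: "exponents bs = [] \<longleftrightarrow> bs = []" for bs
    by (cases bs) auto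
  have ne: "c bs = 0" if "bs \<in> K" "bs \<noteq> []" for bs
  proof -
    let ?U = "exponents ` (K - {[]})"
    have "(\<Sum>u\<in>?U. h (c' u) * monomial u) = (\<Sum>bs\<in>K - {[]}. h (c bs) * prod_list (map generator bs))"
      by (simp add: sum.reindex[OF inj] summand)
    \<comment> \<open>Only the empty word is moved to the right, where it contributes a member of
      \<open>P\<close>.\<close>
    also have "\<dots> = - h (if [] \<in> K then c [] else 0)"
      using zero fin by (auto simp: sum.remove[of K "[]"] h_zero eq_neg_iff_add_eq_0 add.commute)
    finally have "(\<Sum>u\<in>?U. h (c' u) * monomial u) \<in> P"
      by (simp add: P_minus h_in_P)
    moreover have "?U \<subseteq> lists {0, 1, 2} - {[]}"
      using exponents_in_lists by (simp only: image_subset_iff) (simp del: One_nat_def lists_empty add: eq0)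
    ultimately have "c' (exponents bs) = 0"
      using fin that by (intro monomials_independent[of ?U]) auto
    then show ?thesis
      by (simp add: c' \<alpha>_nonzero)
  qed
  show ?thesis
  proof (cases "bs = []")
    case True
    have "(\<Sum>bs\<in>K. h (c bs) * prod_list (map generator bs)) = (\<Sum>bs\<in>{[]}. h (c bs) * prod_list (map generator bs))"
      using fin mem True by (intro sum.mono_neutral_right) (auto simp: ne h_zero)
    with zero have "h (c []) = 0" by simp
    with True show ?thesis
      using h_mult[of "c []" "inverse (c [])"] h_one by (cases "c [] = 0") auto
  qed (use mem ne in blast)
qed

text \<open>Equality would be a relation with coefficients 1 and -1 between two one-letter words.
  Free generation by a set does not exclude it, since the set would then have a single
  element.\<close>

lemma generators_distinct: "h \<alpha> * inverse F \<noteq> inverse F * h \<alpha>"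
proof
  assume "h \<alpha> * inverse F = inverse F * h \<alpha>"
  then have "(\<Sum>bs\<in>{[True], [False]}. h (if bs = [True] then 1 else - 1) * prod_list (map generator bs)) = 0"
    by (simp add: h_one h_minus)
  from generators_independent[OF _ this, of "[True]"] show False by simp
qed

text \<open>As the generators differ, each word over them comes from a unique boolean list, and two
  elements with the same value give a relation as in \<open>generators_independent\<close>. The map
  \<open>\<kappa>\<close> will send \<open>c\<close> to \<open>scale c 1\<close>.\<close>

lemma freely_generates:
  assumes add: "\<And>c c'. \<kappa> (c - c') = \<kappa> c - \<kappa> c'" and inj: "\<And>c :: 'k::field. \<kappa> c = 0 \<Longrightarrow> c = 0"
  shows "freely_generates (\<lambda>c z. h (\<kappa> c) * z) {h \<alpha> * inverse F, inverse F * h \<alpha>}"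
  unfolding freely_generates_def
proof (rule inj_onI)
  let ?S = "{h \<alpha> * inverse F, inverse F * h \<alpha>}"
  let ?eval = "free_algebra_eval (\<lambda>c z. h (\<kappa> c) * z)"
  fix p q :: "'q word \<Rightarrow>\<^sub>0 'k"
  assume p: "p \<in> free_algebra ?S" and q: "q \<in> free_algebra ?S" and eq: "?eval p = ?eval q"
  define word where "word bs = Word (map generator bs)" for bs
  define K where "K = Poly_Mapping.keys p \<union> Poly_Mapping.keys q"
  have inj_gen: "inj generator"
    using generators_distinct generators_distinct[symmetric]
    by (intro injI) (simp split: if_splits)
  have inj_word: "inj word"
  proof (rule injI)
    fix bs cs assume "word bs = word cs"
    then have "map generator bs = map generator cs"
      unfolding word_def by (rule word.inject[THEN iffD1])
    then show "bs = cs"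
      using inj_gen by (rule map_injective)
  qed
  have K: "K \<subseteq> range word"
  proof
    fix w assume "w \<in> K"
    with p q have "set (letters w) \<subseteq> ?S"
      unfolding K_def free_algebra_def by blast
    also have "?S = range generator"
      by (simp add: UNIV_bool insert_commute)
    finally have "set (letters w) \<subseteq> range generator" .
    then have "\<exists>bs. letters w = map generator bs"
      unfolding ex_map_conv by blast
    then obtain bs where "letters w = map generator bs" ..
    then have "w = word bs"
      by (cases w) (simp only: word_def word.sel)
    then show "w \<in> range word" by blast
  qed
  have \<kappa>0: "\<kappa> 0 = 0"
    using add[of 0 0] by simp
  have eval: "?eval r = (\<Sum>w\<in>K. h (\<kappa> (Poly_Mapping.lookup r w)) * prod_list (letters w))"
    if "Poly_Mapping.keys r \<subseteq> K" for r
    unfolding free_algebra_eval_def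
    using that by (intro sum.mono_neutral_left) (auto simp: K_def \<kappa>0 h_zero in_keys_iff)
  define c where "c bs = \<kappa> (Poly_Mapping.lookup p (word bs) - Poly_Mapping.lookup q (word bs))" for bs
  define L where "L = word -` K"
  have K_L: "K = word ` L"
    unfolding L_def image_vimage_eq using K by blast
  have fin: "finite L"
    unfolding L_def using inj_word by (intro finite_vimageI) (auto simp: K_def)
  have "(\<Sum>bs\<in>L. h (c bs) * prod_list (map generator bs)) =
      (\<Sum>w\<in>K. h (\<kappa> (Poly_Mapping.lookup p w - Poly_Mapping.lookup q w)) * prod_list (letters w))"
    unfolding K_L by (simp only: sum.reindex[OF inj_on_subset[OF inj_word subset_UNIV]] o_def c_def)
      (simp only: word_def word.sel)
  also have "\<dots> = ?eval p - ?eval q"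
    by (subst (1 2) eval) (auto simp: K_def add h_diff left_diff_distrib sum_subtractf)
  finally have "(\<Sum>bs\<in>L. h (c bs) * prod_list (map generator bs)) = 0"
    using eq by simp
  from generators_independent[OF fin this] have "Poly_Mapping.lookup p w = Poly_Mapping.lookup q w" if "w \<in> K" for w
    using that inj[of "Poly_Mapping.lookup p w - Poly_Mapping.lookup q w"] by (auto simp: K_L c_def)
  moreover have "Poly_Mapping.lookup p w = Poly_Mapping.lookup q w" if "w \<notin> K" for w
    using that by (simp add: K_def in_keys_iff)
  ultimately have "Poly_Mapping.lookup p w = Poly_Mapping.lookup q w" for w
    by (cases "w \<in> K")
  then show "p = q"
    by (rule poly_mapping_eqI)
qed

end


section \<open>Linear polynomials in the division ring of fractions\<close>

locale skew_fractions = k_algebra scale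
  for scale :: "'k::field \<Rightarrow> 'd::division_ring \<Rightarrow> 'd" +
  fixes \<sigma> \<delta> :: "'d \<Rightarrow> 'd" and \<iota> :: "'d poly \<Rightarrow> 'q::division_ring"
  assumes automorphism: "k_automorphism scale \<sigma>"
    and derivation: "skew_derivation scale \<sigma> \<delta>"
    and fractions: "ore_fractions \<sigma> \<delta> \<iota>"
begin

section \<open>Coefficients, the variable and the scalars in the ring of fractions\<close>

lemma module_hom_\<sigma>: "module_hom scale scale \<sigma>"
  and bij_\<sigma>: "bij \<sigma>"
  and \<sigma>_one: "\<sigma> 1 = 1"
  using automorphism by (auto simp: k_automorphism_def module_hom_iff_linear)

lemma module_hom_\<delta>: "module_hom scale scale \<delta>"
  and \<delta>_mult: "\<delta> (x * y) = \<sigma> x * \<delta> y + \<delta> x * y"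
  using derivation by (auto simp: skew_derivation_def module_hom_iff_linear)

lemmas \<sigma>_zero = module_hom.zero[OF module_hom_\<sigma>]
  and \<sigma>_diff = module_hom.diff[OF module_hom_\<sigma>]
  and \<sigma>_scale = module_hom.scale[OF module_hom_\<sigma>]
  and \<delta>_zero = module_hom.zero[OF module_hom_\<delta>]
  and \<delta>_diff = module_hom.diff[OF module_hom_\<delta>]
  and \<delta>_scale = module_hom.scale[OF module_hom_\<delta>]

lemma \<sigma>_eq_0: "\<sigma> x = 0 \<longleftrightarrow> x = 0"
  using bij_\<sigma> \<sigma>_zero by (metis bij_is_inj injD)

lemma \<delta>_one: "\<delta> 1 = 0"
  using \<delta>_mult[of 1 1] by (simp add: \<sigma>_one)

lemma inj_\<iota>: "inj \<iota>"
  and \<iota>_add: "\<iota> (p + q) = \<iota> p + \<iota> q"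
  and \<iota>_mult: "\<iota> (skew_times \<sigma> \<delta> p q) = \<iota> p * \<iota> q"
  using fractions by (auto simp: ore_fractions_def)

definition h :: "'d \<Rightarrow> 'q" where "h x = \<iota> [:x:]"

definition X :: 'q where "X = \<iota> [:0, 1:]"

lemma \<iota>_zero: "\<iota> 0 = 0"
  using \<iota>_add[of 0 0] by simp

lemma \<iota>_eq_0: "\<iota> p = 0 \<longleftrightarrow> p = 0"
  using inj_\<iota> \<iota>_zero by (metis injD)

lemma h_add: "h (x + y) = h x + h y"
  unfolding h_def by (simp flip: \<iota>_add)

lemma h_diff: "h (x - y) = h x - h y"
  using h_add[of "x - y" y] by (simp add: algebra_simps)

lemma h_mult_\<iota>: "h x * \<iota> p = \<iota> (map_poly (\<lambda>y. x * y) p)"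
  by (simp add: h_def skew_times_const flip: \<iota>_mult)

lemma h_mult: "h (x * y) = h x * h y"
  by (subst (2) h_def, subst h_mult_\<iota>) (simp add: h_def map_poly_pCons)

lemma h_zero: "h 0 = 0"
  by (simp add: h_def \<iota>_zero)

lemma h_one: "h 1 = 1"
  using fractions by (simp add: ore_fractions_def h_def)

lemma h_eq_0: "h x = 0 \<longleftrightarrow> x = 0"
  by (simp add: h_def \<iota>_eq_0)

lemma X_mult_\<iota>: "X * \<iota> p = \<iota> (skew_X_times \<sigma> \<delta> p)"
proof -
  have "map_poly ((*) 0) p = 0" and "map_poly ((*) 1) (skew_X_times \<sigma> \<delta> p) = skew_X_times \<sigma> \<delta> p"
    by (auto intro!: poly_eqI simp: coeff_map_poly)
  then have "skew_times \<sigma> \<delta> [:0, 1:] p = skew_X_times \<sigma> \<delta> p"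
    by (simp add: skew_times_def)
  then show ?thesis
    by (simp add: X_def flip: \<iota>_mult)
qed

lemma X_mult_h: "X * h x = h (\<sigma> x) * X + h (\<delta> x)"
proof -
  have "X * h x = \<iota> (pCons 0 [:\<sigma> x:] + [:\<delta> x:])"
    by (simp add: h_def X_mult_\<iota> skew_X_times_def map_poly_pCons \<sigma>_zero \<delta>_zero)
  also have "\<dots> = h (\<sigma> x) * X + h (\<delta> x)"
    unfolding X_def h_mult_\<iota> \<iota>_add by (simp add: map_poly_pCons h_def)
  finally show ?thesis .
qed

lemma \<iota>_monom: "\<iota> (monom x n) = h x * X ^ n"
proof -
  have "\<iota> (monom 1 n) = X ^ n"
  proof (induction n)
    case 0
    then show ?case using h_one by (simp add: h_def monom_0)
  next
    case (Suc n)
    have "skew_X_times \<sigma> \<delta> (monom 1 n) = monom 1 (Suc n)"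
      by (simp add: skew_X_times_def map_poly_monom \<sigma>_zero \<delta>_zero \<sigma>_one \<delta>_one monom_Suc)
    with Suc show ?case
      using X_mult_\<iota>[of "monom 1 n"] by simp
  qed
  then show ?thesis
    by (metis h_mult_\<iota> map_poly_monom mult_zero_right mult_1_right)
qed

definition \<kappa> :: "'k \<Rightarrow> 'q" where "\<kappa> c = h (scale c 1)"

lemma \<kappa>_mult_h: "\<kappa> c * h x = h (scale c x)"
  by (simp add: \<kappa>_def scale_mult_left flip: h_mult)

lemma h_mult_\<kappa>: "h x * \<kappa> c = h (scale c x)"
  by (simp add: \<kappa>_def scale_mult_right flip: h_mult)

lemma \<kappa>_commute_h: "\<kappa> c * h x = h x * \<kappa> c"
  by (simp add: \<kappa>_mult_h h_mult_\<kappa>)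

lemma \<kappa>_mult: "\<kappa> c * \<kappa> d = \<kappa> (c * d)"
  by (simp add: \<kappa>_mult_h \<kappa>_def[of d]) (simp add: \<kappa>_def)

lemma \<kappa>_commute: "\<kappa> c * \<kappa> d = \<kappa> d * \<kappa> c"
  by (simp add: \<kappa>_mult mult.commute)

lemma \<kappa>_one: "\<kappa> 1 = 1"
  by (simp add: \<kappa>_def h_one)

lemma \<kappa>_zero: "\<kappa> 0 = 0"
  by (simp add: \<kappa>_def h_zero)

lemma \<kappa>_eq_0: "\<kappa> c = 0 \<longleftrightarrow> c = 0"
  by (simp add: \<kappa>_def h_eq_0)

lemma inverse_\<kappa>: "inverse (\<kappa> c) = \<kappa> (inverse c)"
proof (cases "c = 0")
  case False
  then have "\<kappa> c * \<kappa> (inverse c) = 1"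
    by (simp add: \<kappa>_mult \<kappa>_one)
  then show ?thesis by (rule inverse_unique)
qed (simp add: \<kappa>_zero)

lemma \<kappa>_commute_X: "\<kappa> c * X = X * \<kappa> c"
  by (simp add: \<kappa>_def X_mult_h \<sigma>_scale \<delta>_scale \<sigma>_one \<delta>_one h_zero)

lemma X_nonzero: "X \<noteq> 0"
  by (simp add: X_def \<iota>_eq_0)

section \<open>Linear polynomials with scalar coefficients\<close>

definition linear_poly :: "'k \<Rightarrow> 'k \<Rightarrow> 'q" where
  "linear_poly a0 a1 = \<kappa> a0 + \<kappa> a1 * X"

lemma \<iota>_linear: "\<iota> [:scale a0 1, scale a1 1:] = linear_poly a0 a1"
proof -
  have "[:scale a0 1, scale a1 1:] = [:scale a0 1:] + monom (scale a1 1) 1"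
    by (simp add: monom_Suc monom_0)
  then show ?thesis
    by (simp only: \<iota>_add \<iota>_monom) (simp add: linear_poly_def \<kappa>_def h_def)
qed

lemma linear_poly_nonzero: "a1 \<noteq> 0 \<Longrightarrow> linear_poly a0 a1 \<noteq> 0"
  by (simp add: \<iota>_eq_0 flip: \<iota>_linear)

lemma linear_poly_commute_\<kappa>: "linear_poly a0 a1 * \<kappa> c = \<kappa> c * linear_poly a0 a1"
  unfolding linear_poly_def distrib_left distrib_right
  by (metis \<kappa>_commute \<kappa>_commute_X mult.assoc)

lemma linear_poly_commute_X: "linear_poly a0 a1 * X = X * linear_poly a0 a1"
  unfolding linear_poly_def distrib_left distrib_right
  by (metis \<kappa>_commute_X mult.assoc)

text \<open>The \<open>\<psi>\<close> of the theorem: the defect in the commutation of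
  \<open>a0 + a1 X\<close> with a coefficient.\<close>

definition twisted :: "'k \<Rightarrow> 'k \<Rightarrow> 'd \<Rightarrow> 'd" where
  "twisted a0 a1 x = scale a1 (\<delta> x) + scale a0 (x - \<sigma> x)"

lemma twisted_one: "twisted a0 a1 1 = 0"
  by (simp add: twisted_def \<sigma>_one \<delta>_one)

lemma twisted_diff: "twisted a0 a1 (x - y) = twisted a0 a1 x - twisted a0 a1 y"
  by (simp add: twisted_def \<sigma>_diff \<delta>_diff scale_right_diff_distrib)

lemma twisted_scale: "twisted a0 a1 (scale c x) = scale c (twisted a0 a1 x)"
  by (simp add: twisted_def \<sigma>_scale \<delta>_scale scale_right_diff_distrib scale_right_distrib mult.commute)

lemma linear_poly_mult_h:
  "linear_poly a0 a1 * h x = h (\<sigma> x) * linear_poly a0 a1 + h (twisted a0 a1 x)"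
proof -
  have "linear_poly a0 a1 * h x = h (scale a0 x) + \<kappa> a1 * (h (\<sigma> x) * X + h (\<delta> x))"
    by (simp add: linear_poly_def distrib_right mult.assoc X_mult_h \<kappa>_mult_h)
  also have "\<dots> = h (scale a0 x) + h (\<sigma> x) * \<kappa> a1 * X + h (scale a1 (\<delta> x))"
    by (simp add: distrib_left \<kappa>_commute_h flip: mult.assoc) (simp add: h_mult_\<kappa> add.assoc)
  also have "\<dots> = h (\<sigma> x) * linear_poly a0 a1 + h (twisted a0 a1 x)"
    by (simp add: linear_poly_def distrib_left h_mult_\<kappa> twisted_def h_add h_diff
        scale_right_diff_distrib flip: mult.assoc)
  finally show ?thesis .
qed

lemma linear_poly_mult_\<iota>:
  "linear_poly a0 a1 * \<iota> p = \<iota> (map_poly (scale a0) p + map_poly (scale a1) (skew_X_times \<sigma> \<delta> p))"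
proof -
  have "\<kappa> c * \<iota> p = \<iota> (map_poly (scale c) p)" for c p
  proof -
    have "(*) (scale c 1) = scale c"
      by (rule ext) (simp add: scale_mult_left)
    then show ?thesis
      by (simp add: \<kappa>_def h_mult_\<iota>)
  qed
  then show ?thesis
    by (simp add: linear_poly_def distrib_right mult.assoc X_mult_\<iota> \<iota>_add)
qed

text \<open>If \<open>p\<close> is nonzero, the product has degree \<open>degree p + 1\<close>,
  which must be \<open>n\<close>; this excludes \<open>n = 0\<close>. In the other case the
  coefficients below \<open>n\<close> vanish one after another from degree 0 upwards, because
  \<open>a0\<close> is invertible. This supplies \<open>P_no_inverse\<close> in both cases of the
  theorem.\<close>

lemma linear_poly_mult_eq_monomial:
  assumes eq: "linear_poly a0 a1 * \<iota> p = h x * X ^ n" and a1: "a1 \<noteq> 0"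
    and n: "n = 0 \<or> a0 \<noteq> 0 \<and> \<delta> = (\<lambda>_. 0)"
  shows "x = 0"
proof -
  have "\<iota> (map_poly (scale a0) p + map_poly (scale a1) (skew_X_times \<sigma> \<delta> p)) = \<iota> (monom x n)"
    using eq by (simp only: linear_poly_mult_\<iota> \<iota>_monom)
  then have poly_eq: "map_poly (scale a0) p + map_poly (scale a1) (skew_X_times \<sigma> \<delta> p) = monom x n"
    by (rule injD[OF inj_\<iota>])
  have coeff: "scale a0 (coeff p j) +
      scale a1 ((case j of 0 \<Rightarrow> 0 | Suc i \<Rightarrow> \<sigma> (coeff p i)) + \<delta> (coeff p j)) = (if j = n then x else 0)" for j
  proof -
    have "scale a0 (coeff p j) +
        scale a1 ((case j of 0 \<Rightarrow> 0 | Suc i \<Rightarrow> \<sigma> (coeff p i)) + \<delta> (coeff p j)) =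
        coeff (map_poly (scale a0) p + map_poly (scale a1) (skew_X_times \<sigma> \<delta> p)) j"
      by (simp add: coeff_map_poly skew_X_times_def coeff_pCons \<sigma>_zero \<delta>_zero split: nat.split)
    also have "\<dots> = (if j = n then x else 0)"
      unfolding poly_eq by simp
    finally show ?thesis .
  qed
  have "p = 0"
  proof (rule ccontr)
    assume "p \<noteq> 0"
    then have lead: "coeff p (degree p) \<noteq> 0" by simp
    have "(if Suc (degree p) = n then x else 0) = scale a1 (\<sigma> (coeff p (degree p)))"
      using coeff[of "Suc (degree p)"] by (simp add: coeff_eq_0 \<delta>_zero)
    with a1 lead have n_eq: "n = Suc (degree p)"
      by (auto simp: \<sigma>_eq_0 split: if_splits)
    with n have "a0 \<noteq> 0" and \<delta>0: "\<delta> y = 0" for y by auto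
    \<comment> \<open>As \<open>n = Suc (degree p)\<close>, this range includes the leading
      coefficient.\<close>
    have "coeff p j = 0" if "j < n" for j
      using that
    proof (induction j)
      case 0
      with coeff[of 0] \<open>a0 \<noteq> 0\<close> show ?case by (simp add: \<delta>0)
    next
      case (Suc j)
      with coeff[of "Suc j"] \<open>a0 \<noteq> 0\<close> show ?case by (simp add: \<delta>0 \<sigma>_zero)
    qed
    with n_eq lead show False by simp
  qed
  with eq X_nonzero show ?thesis
    by (simp add: \<iota>_zero h_eq_0)
qed

section \<open>Closure of the skew polynomials, and freeness in the two cases\<close>

lemma range_\<iota>_add: "z \<in> range \<iota> \<Longrightarrow> w \<in> range \<iota> \<Longrightarrow> z + w \<in> range \<iota>"
  by (auto simp flip: \<iota>_add)

lemma range_\<iota>_mult: "z \<in> range \<iota> \<Longrightarrow> w \<in> range \<iota> \<Longrightarrow> z * w \<in> range \<iota>"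
  by (auto simp flip: \<iota>_mult)

lemma h_in_range: "h x \<in> range \<iota>"
  by (simp add: h_def)

lemma X_power_in_range: "X ^ n \<in> range \<iota>"
  using \<iota>_monom[of 1 n] h_one by (metis mult_1_left rangeI)

lemma linear_poly_in_range: "linear_poly a0 a1 \<in> range \<iota>"
  by (metis \<iota>_linear rangeI)

text \<open>
  Here \<open>\<Xi>\<^sup>-\<^sup>1 = \<beta>\<^sup>-\<^sup>1 f\<close> inherits the commutation rule of \<open>f\<close>.
\<close>

lemma free_case_constant:
  assumes a1: "a1 \<noteq> 0" and \<beta>: "\<beta> \<noteq> 0"
    and indep: "left_independent (\<sigma> ` {x. twisted a0 a1 x = 0}) {0, 1, 2 :: nat} (\<lambda>i. \<alpha> ^ i)"
    and disjoint: "\<And>c y. (\<And>i. i \<in> {0, 1, 2 :: nat} \<Longrightarrow> c i \<in> \<sigma> ` {x. twisted a0 a1 x = 0}) \<Longrightarrow>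
      y \<in> range (twisted a0 a1) \<Longrightarrow> y = (\<Sum>i\<in>{0, 1, 2 :: nat}. c i * \<alpha> ^ i) \<Longrightarrow> y = 0"
    and \<Xi>: "\<Xi> = \<kappa> \<beta> * inverse (linear_poly a0 a1)"
  shows "h \<alpha> * \<Xi> \<noteq> \<Xi> * h \<alpha> \<and> freely_generates (\<lambda>c z. \<kappa> c * z) {h \<alpha> * \<Xi>, \<Xi> * h \<alpha>}"
proof -
  define F where "F = linear_poly a0 a1 * \<kappa> (inverse \<beta>)"
  \<comment> \<open>Division by the scalar \<open>\<beta>\<close> changes neither the kernel nor the
    range.\<close>
  define \<psi> where "\<psi> x = scale (inverse \<beta>) (twisted a0 a1 x)" for x
  have F_eq: "F = \<kappa> (inverse \<beta>) * linear_poly a0 a1"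
    by (simp add: F_def linear_poly_commute_\<kappa>)
  have ker: "{x. \<psi> x = 0} = {x. twisted a0 a1 x = 0}"
    using \<beta> by (simp add: \<psi>_def)
  have range: "\<psi> x \<in> range (twisted a0 a1)" for x
    by (simp add: \<psi>_def flip: twisted_scale)
  have inv_F: "inverse F = \<Xi>"
    using linear_poly_nonzero[OF a1] \<beta>
    by (simp add: F_def \<Xi> nonzero_inverse_mult_distrib \<kappa>_eq_0 flip: inverse_\<kappa>)
  interpret skew_inverse h \<sigma> \<psi> F "range \<iota>" \<alpha>
  proof
    show "F * h x = h (\<sigma> x) * F + h (\<psi> x)" for x
    proof -
      have "F * h x = \<kappa> (inverse \<beta>) * (h (\<sigma> x) * linear_poly a0 a1 + h (twisted a0 a1 x))"
        by (simp add: F_eq mult.assoc linear_poly_mult_h)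
      also have "\<dots> = \<kappa> (inverse \<beta>) * h (\<sigma> x) * linear_poly a0 a1 + h (\<psi> x)"
        by (simp add: distrib_left \<kappa>_mult_h[of _ "twisted a0 a1 x"] \<psi>_def flip: mult.assoc)
      also have "\<dots> = h (\<sigma> x) * F + h (\<psi> x)"
        by (simp add: F_eq \<kappa>_commute_h mult.assoc)
      finally show ?thesis .
    qed
    show "F \<noteq> 0"
      using linear_poly_nonzero[OF a1] \<beta> by (simp add: F_def \<kappa>_eq_0)
    show "left_independent (\<sigma> ` {x. \<psi> x = 0}) {0, 1, 2 :: nat} (\<lambda>i. \<alpha> ^ i)"
      using indep by (simp only: ker)
    show "\<psi> x = 0" if "\<And>i. i \<in> {0, 1, 2 :: nat} \<Longrightarrow> c i \<in> \<sigma> ` {x. \<psi> x = 0}"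
      and "\<psi> x = (\<Sum>i\<in>{0, 1, 2 :: nat}. c i * \<alpha> ^ i)" for c x
      using disjoint[OF that(1)[unfolded ker] range that(2)] by blast
    show "F * q \<in> range \<iota>" if "q \<in> range \<iota>" for q
      using that by (simp add: F_def \<kappa>_def range_\<iota>_mult h_in_range linear_poly_in_range)
    show "x = 0" if "q \<in> range \<iota>" and "F * q = h x" for q x
    proof -
      have "\<kappa> (inverse \<beta>) * q \<in> range \<iota>"
        using that(1) by (simp add: \<kappa>_def range_\<iota>_mult h_in_range)
      then obtain p where p: "\<kappa> (inverse \<beta>) * q = \<iota> p" by blast
      have "linear_poly a0 a1 * \<iota> p = h x * X ^ 0"
        using that(2) by (simp add: F_def mult.assoc flip: p)
      then show ?thesis
        using a1 by (rule linear_poly_mult_eq_monomial) simp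
    qed
  qed (simp_all add: h_add h_mult h_one \<sigma>_one \<psi>_def twisted_one twisted_diff
      scale_right_diff_distrib range_\<iota>_add range_\<iota>_mult h_in_range)
  have "freely_generates (\<lambda>c z. h (scale c 1) * z) {h \<alpha> * inverse F, inverse F * h \<alpha>}"
    by (rule freely_generates) (simp_all add: scale_left_diff_distrib)
  with generators_distinct show ?thesis
    by (simp add: inv_F \<kappa>_def)
qed

text \<open>
  Here \<open>\<Xi>\<^sup>-\<^sup>1 = \<beta>\<^sup>-\<^sup>1 (a\<^sub>1 + a\<^sub>0 X\<^sup>-\<^sup>1)\<close>, and \<open>X\<^sup>-\<^sup>1 a = \<sigma>\<^sup>-\<^sup>1(a) X\<^sup>-\<^sup>1\<close>: this is the previous case for
  \<open>\<sigma>\<^sup>-\<^sup>1\<close> in place of \<open>\<sigma>\<close>, with the Laurent polynomials in place of \<open>D[X;\<sigma>]\<close>.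
\<close>

lemma free_case_X:
  assumes a0: "a0 \<noteq> 0" and a1: "a1 \<noteq> 0" and \<beta>: "\<beta> \<noteq> 0" and \<delta>: "\<delta> = (\<lambda>_. 0)"
    and indep: "left_independent (\<sigma> ` {x. twisted a0 a1 x = 0}) {0, 1, 2 :: nat} (\<lambda>i. \<alpha> ^ i)"
    and disjoint: "\<And>c y. (\<And>i. i \<in> {0, 1, 2 :: nat} \<Longrightarrow> c i \<in> \<sigma> ` {x. twisted a0 a1 x = 0}) \<Longrightarrow>
      y \<in> range (twisted a0 a1) \<Longrightarrow> y = (\<Sum>i\<in>{0, 1, 2 :: nat}. c i * \<alpha> ^ i) \<Longrightarrow> y = 0"
    and \<Xi>: "\<Xi> = \<kappa> \<beta> * X * inverse (linear_poly a0 a1)"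
  shows "h \<alpha> * \<Xi> \<noteq> \<Xi> * h \<alpha> \<and> freely_generates (\<lambda>c z. \<kappa> c * z) {h \<alpha> * \<Xi>, \<Xi> * h \<alpha>}"
proof -
  define \<tau> where "\<tau> = inv \<sigma>"
  have \<sigma>\<tau>: "\<sigma> (\<tau> x) = x" and \<tau>\<sigma>: "\<tau> (\<sigma> x) = x" for x
    using bij_\<sigma> by (simp_all add: \<tau>_def surj_f_inv_f bij_is_surj inv_f_f bij_is_inj)
  have \<tau>_one: "\<tau> 1 = 1"
    using \<tau>\<sigma>[of 1] by (simp add: \<sigma>_one)
  have \<tau>_diff: "\<tau> (x - y) = \<tau> x - \<tau> y" for x y
    using \<tau>\<sigma>[of "\<tau> x - \<tau> y"] by (simp add: \<sigma>_diff \<sigma>\<tau>)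
  define F where "F = linear_poly a0 a1 * inverse X * \<kappa> (inverse \<beta>)"
  define g where "g = linear_poly a0 a1 * \<kappa> (inverse \<beta>)"
  \<comment> \<open>The summand of \<open>F\<close> in the inverse of \<open>X\<close> obeys the
    rule for \<open>\<tau>\<close> without defect, so only the constant \<open>a1 / \<beta>\<close>
    contributes.\<close>
  define \<psi> where "\<psi> x = scale (a1 / \<beta>) (x - \<tau> x)" for x
  have \<delta>0: "\<delta> x = 0" for x
    by (simp only: \<delta>)
  have tw: "twisted a0 a1 x = scale a0 (x - \<sigma> x)" for x
    by (simp add: twisted_def \<delta>0)
  have X_h: "X * h x = h (\<sigma> x) * X" for x
    by (simp add: X_mult_h \<delta>0 h_zero)
  have inv_X_h: "inverse X * h x = h (\<tau> x) * inverse X" for x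
  proof -
    have "inverse X * h x * X = inverse X * (X * h (\<tau> x))"
      by (simp add: X_h \<sigma>\<tau> mult.assoc)
    also have "\<dots> = h (\<tau> x) * inverse X * X"
      using X_nonzero by (simp add: mult.assoc) (simp flip: mult.assoc)
    finally show ?thesis
      using X_nonzero by simp
  qed
  have fixed: "\<tau> x = x \<longleftrightarrow> \<sigma> x = x" for x
    by (metis \<sigma>\<tau> \<tau>\<sigma>)
  have ker: "{x. \<psi> x = 0} = {x. \<sigma> x = x}" and ker': "{x. twisted a0 a1 x = 0} = {x. \<sigma> x = x}"
    using a0 a1 \<beta> by (simp_all add: \<psi>_def tw fixed eq_commute[of _ "\<tau> _"] eq_commute[of _ "\<sigma> _"])
  \<comment> \<open>Both kernels consist of the fixed elements of \<open>\<sigma>\<close>, which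
    \<open>\<tau>\<close> fixes as well.\<close>
  have image: "\<tau> ` {x. \<psi> x = 0} = \<sigma> ` {x. twisted a0 a1 x = 0}"
    unfolding ker ker' by (rule image_cong) (simp_all add: fixed[THEN iffD2])
  have range: "\<psi> x \<in> range (twisted a0 a1)" for x
  proof -
    \<comment> \<open>The twisted map sends \<open>\<tau> x\<close> to
      \<open>a0 (\<tau> x - x)\<close>; the scalar corrects the factor and the sign.\<close>
    have "\<psi> x = twisted a0 a1 (scale (- (a1 / \<beta> / a0)) (\<tau> x))"
      unfolding twisted_scale using a0 by (simp add: tw \<sigma>\<tau> \<psi>_def scale_right_diff_distrib)
    then show ?thesis by blast
  qed
  have F_nonzero: "F \<noteq> 0"
    using linear_poly_nonzero[OF a1] \<beta> X_nonzero by (simp add: F_def \<kappa>_eq_0)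
  have inv_F: "inverse F = \<Xi>"
    using linear_poly_nonzero[OF a1] \<beta> X_nonzero
    by (simp add: F_def \<Xi> nonzero_inverse_mult_distrib \<kappa>_eq_0 mult.assoc flip: inverse_\<kappa>)
  have F_eq: "F = \<kappa> (inverse \<beta>) * (\<kappa> a0 * inverse X + \<kappa> a1)"
  proof -
    have "linear_poly a0 a1 * inverse X = \<kappa> a0 * inverse X + \<kappa> a1"
      using X_nonzero by (simp add: linear_poly_def distrib_right mult.assoc)
    moreover have "inverse X * \<kappa> c = \<kappa> c * inverse X" for c
      by (simp add: \<kappa>_def inv_X_h) (use \<sigma>_scale[of c 1] \<tau>\<sigma>[of "scale c 1"] in \<open>simp add: \<sigma>_one\<close>)
    ultimately have "F = \<kappa> a0 * \<kappa> (inverse \<beta>) * inverse X + \<kappa> a1 * \<kappa> (inverse \<beta>)"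
      by (simp add: F_def distrib_right mult.assoc)
    then show ?thesis
      by (simp only: distrib_left mult.assoc[symmetric] \<kappa>_commute)
  qed
  have g_X: "g * X = X * g"
    unfolding g_def by (metis linear_poly_commute_X \<kappa>_commute_X mult.assoc)
  \<comment> \<open>One factor \<open>X\<close> clears the denominator of \<open>F\<close> and
    leaves \<open>g\<close>, which commutes with \<open>X\<close>.\<close>
  have X_F: "X ^ Suc n * F = g * X ^ n" for n
  proof -
    have "X * F = g"
      using X_nonzero
      by (simp add: F_def g_def mult.assoc[symmetric] linear_poly_commute_X[symmetric])
        (simp add: mult.assoc)
    then have "X ^ Suc n * F = X ^ n * g"
      by (simp only: power_Suc2 mult.assoc)
    also have "\<dots> = g * X ^ n"
      by (simp add: power_commuting_commutes g_X)
    finally show ?thesis .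
  qed
  have X_power_h: "X ^ n * h x = h ((\<sigma> ^^ n) x) * X ^ n" for n x
  proof (induction n)
    case (Suc n)
    then show ?case
      by (simp add: mult.assoc) (simp add: X_h flip: mult.assoc)
  qed simp
  \<comment> \<open>The set consists of the Laurent polynomials: elements that some power of
    \<open>X\<close> moves into the skew polynomials.\<close>
  interpret skew_inverse h \<tau> \<psi> F "{q. \<exists>n. X ^ n * q \<in> range \<iota>}" \<alpha>
  proof
    show "F * h x = h (\<tau> x) * F + h (\<psi> x)" for x
    proof -
      have "F * h x = \<kappa> (inverse \<beta>) * (\<kappa> a0 * h (\<tau> x) * inverse X + \<kappa> a1 * h x)"
        by (simp add: F_eq distrib_left distrib_right mult.assoc inv_X_h)
      moreover have "h (\<tau> x) * F = \<kappa> (inverse \<beta>) * (\<kappa> a0 * h (\<tau> x) * inverse X + \<kappa> a1 * h (\<tau> x))"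
        by (simp add: F_eq distrib_left flip: mult.assoc) (simp add: h_mult_\<kappa> \<kappa>_mult \<kappa>_mult_h mult.commute)
      moreover have "h (\<psi> x) = \<kappa> (inverse \<beta>) * (\<kappa> a1 * h x - \<kappa> a1 * h (\<tau> x))"
        by (simp add: \<psi>_def right_diff_distrib \<kappa>_mult_h scale_right_diff_distrib h_diff field_simps)
      ultimately show ?thesis
        by (simp add: right_diff_distrib distrib_left)
    qed
    show "F \<noteq> 0" by (rule F_nonzero)
    show "left_independent (\<tau> ` {x. \<psi> x = 0}) {0, 1, 2 :: nat} (\<lambda>i. \<alpha> ^ i)"
      using indep by (simp only: image)
    show "\<psi> x = 0" if "\<And>i. i \<in> {0, 1, 2 :: nat} \<Longrightarrow> c i \<in> \<tau> ` {x. \<psi> x = 0}"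
      and "\<psi> x = (\<Sum>i\<in>{0, 1, 2 :: nat}. c i * \<alpha> ^ i)" for c x
      using disjoint[OF that(1)[unfolded image] range that(2)] by blast
    show "h x \<in> {q. \<exists>n. X ^ n * q \<in> range \<iota>}" for x
      by (auto intro!: exI[of _ 0] h_in_range)
    show "p + q \<in> {q. \<exists>n. X ^ n * q \<in> range \<iota>}"
      if "p \<in> {q. \<exists>n. X ^ n * q \<in> range \<iota>}" and "q \<in> {q. \<exists>n. X ^ n * q \<in> range \<iota>}" for p q
    proof -
      from that obtain m n where mn: "X ^ m * p \<in> range \<iota>" "X ^ n * q \<in> range \<iota>" by blast
      have "X ^ (m + n) * (p + q) = X ^ n * (X ^ m * p) + X ^ m * (X ^ n * q)"
        by (simp add: distrib_left add.commute flip: mult.assoc power_add)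
      with mn have "X ^ (m + n) * (p + q) \<in> range \<iota>"
        by (simp add: range_\<iota>_add range_\<iota>_mult X_power_in_range)
      then show ?thesis by blast
    qed
    show "h x * q \<in> {q. \<exists>n. X ^ n * q \<in> range \<iota>}" if "q \<in> {q. \<exists>n. X ^ n * q \<in> range \<iota>}" for q x
    proof -
      from that obtain n where n: "X ^ n * q \<in> range \<iota>" by blast
      have "X ^ n * (h x * q) = h ((\<sigma> ^^ n) x) * (X ^ n * q)"
        by (simp add: X_power_h flip: mult.assoc)
      with n have "X ^ n * (h x * q) \<in> range \<iota>"
        by (simp add: range_\<iota>_mult h_in_range)
      then show ?thesis by blast
    qed
    show "F * q \<in> {q. \<exists>n. X ^ n * q \<in> range \<iota>}" if "q \<in> {q. \<exists>n. X ^ n * q \<in> range \<iota>}" for q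
    proof -
      from that obtain n where n: "X ^ n * q \<in> range \<iota>" by blast
      have "X ^ Suc n * (F * q) = g * (X ^ n * q)"
        by (simp add: X_F flip: mult.assoc power_Suc)
      with n have "X ^ Suc n * (F * q) \<in> range \<iota>"
        by (simp only: g_def \<kappa>_def range_\<iota>_mult h_in_range linear_poly_in_range)
      then show ?thesis by blast
    qed
    show "x = 0" if "q \<in> {q. \<exists>n. X ^ n * q \<in> range \<iota>}" and "F * q = h x" for q x
    proof -
      from that(1) obtain n p where p: "X ^ n * q = \<iota> p" by blast
      \<comment> \<open>Multiplying \<open>F * q = h x\<close> by \<open>X ^ Suc n\<close> and by
        \<open>\<beta>\<close> makes \<open>f p\<close> a monomial of degree \<open>Suc n\<close>,
        the case that relies on \<open>a0 \<noteq> 0\<close>.\<close>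
      define y where "y = (\<sigma> ^^ Suc n) x"
      have "g * \<iota> p = X ^ Suc n * (F * q)"
        by (simp add: X_F flip: p mult.assoc power_Suc)
      also have "\<dots> = h y * X ^ Suc n"
        by (simp only: that(2) X_power_h y_def)
      finally have "\<kappa> \<beta> * (g * \<iota> p) = \<kappa> \<beta> * (h y * X ^ Suc n)" by simp
      moreover have "\<kappa> \<beta> * g = linear_poly a0 a1"
        unfolding g_def linear_poly_commute_\<kappa> using \<beta> by (simp add: \<kappa>_mult \<kappa>_one flip: mult.assoc)
      ultimately have "linear_poly a0 a1 * \<iota> p = h (scale \<beta> y) * X ^ Suc n"
        by (metis mult.assoc \<kappa>_mult_h)
      then have "scale \<beta> y = 0"
        using a1 by (rule linear_poly_mult_eq_monomial) (use a0 \<delta> in blast)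
      with \<beta> have "(\<sigma> ^^ Suc n) x = 0" by (simp add: y_def)
      moreover have "(\<sigma> ^^ m) x = 0 \<Longrightarrow> x = 0" for m
        by (induction m) (simp_all add: \<sigma>_eq_0)
      ultimately show ?thesis by blast
    qed
  qed (simp_all add: h_add h_mult h_one \<tau>_one \<psi>_def \<tau>_diff scale_right_diff_distrib)
  have "freely_generates (\<lambda>c z. h (scale c 1) * z) {h \<alpha> * inverse F, inverse F * h \<alpha>}"
    by (rule freely_generates) (simp_all add: scale_left_diff_distrib)
  with generators_distinct show ?thesis
    by (simp add: inv_F \<kappa>_def)
qed

end

section \<open>Reduction of the theorem to the two cases\<close>

theorem theorem2p1:
  fixes scale :: "'k::field \<Rightarrow> 'd::division_ring \<Rightarrow> 'd"
    and \<sigma> \<delta> \<psi> :: "'d \<Rightarrow> 'd"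
    and \<iota> :: "'d poly \<Rightarrow> 'q::division_ring"
    and a0 a1 b0 b1 :: 'k
    and f g :: "'d poly"
    and \<Xi> :: 'q
    and E :: "'d set"
    and \<alpha> :: 'd
  assumes "k_algebra scale"
    and "k_automorphism scale \<sigma>"
    and "skew_derivation scale \<sigma> \<delta>"
    and "ore_fractions \<sigma> \<delta> \<iota>"
    and "a1 \<noteq> 0"
    and "f = [:scale a0 1, scale a1 1:]"
    and "g = [:scale b0 1, scale b1 1:]"
    and "\<Xi> = \<iota> g * inverse (\<iota> f)"
    and "\<Xi> \<notin> range (\<lambda>c. \<iota> [:scale c 1:])"
    and "\<psi> = (\<lambda>x. scale a1 (\<delta> x) + scale a0 (x - \<sigma> x))"
    and "E = {x. \<psi> x = 0}"
    and "left_independent (\<sigma> ` E) {0, 1, 2 :: nat} (\<lambda>i. \<alpha> ^ i)"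
    and "range \<psi> \<inter> {c0 + c1 * \<alpha> + c2 * \<alpha>\<^sup>2 | c0 c1 c2. c0 \<in> \<sigma> ` E \<and> c1 \<in> \<sigma> ` E \<and> c2 \<in> \<sigma> ` E} = {0}"
    and "b1 = 0 \<or> (b0 = 0 \<and> \<delta> = (\<lambda>_. 0))"
  shows "\<iota> [:\<alpha>:] * \<Xi> \<noteq> \<Xi> * \<iota> [:\<alpha>:] \<and>
    freely_generates (\<lambda>c z. \<iota> [:scale c 1:] * z) {\<iota> [:\<alpha>:] * \<Xi>, \<Xi> * \<iota> [:\<alpha>:]}"
proof -
  interpret skew_fractions scale \<sigma> \<delta> \<iota>
    using assms(1-4) by (simp add: skew_fractions_def skew_fractions_axioms_def)
  have \<psi>: "\<psi> = twisted a0 a1"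
    by (rule ext) (simp add: \<open>\<psi> = _\<close> twisted_def)
  have E: "E = {x. twisted a0 a1 x = 0}"
    by (simp add: \<open>E = _\<close> \<psi>)
  have indep: "left_independent (\<sigma> ` {x. twisted a0 a1 x = 0}) {0, 1, 2 :: nat} (\<lambda>i. \<alpha> ^ i)"
    using assms(12) by (simp only: E)
  have disjoint: "y = 0" if c: "\<And>i. i \<in> {0, 1, 2 :: nat} \<Longrightarrow> c i \<in> \<sigma> ` {x. twisted a0 a1 x = 0}"
    and y: "y \<in> range (twisted a0 a1)" and sum: "y = (\<Sum>i\<in>{0, 1, 2 :: nat}. c i * \<alpha> ^ i)" for c y
  proof -
    have "y = c 0 + c 1 * \<alpha> + c 2 * \<alpha>\<^sup>2"
      using sum by (simp add: add.assoc)
    moreover have "c 0 \<in> \<sigma> ` E" "c 1 \<in> \<sigma> ` E" "c 2 \<in> \<sigma> ` E"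
      using c by (simp_all only: E insert_iff simp_thms)
    ultimately have "y \<in> {c0 + c1 * \<alpha> + c2 * \<alpha>\<^sup>2 | c0 c1 c2. c0 \<in> \<sigma> ` E \<and> c1 \<in> \<sigma> ` E \<and> c2 \<in> \<sigma> ` E}"
      by blast
    with y assms(13) show ?thesis unfolding \<psi> by blast
  qed
  have \<Xi>: "\<Xi> = (\<kappa> b0 + \<kappa> b1 * X) * inverse (linear_poly a0 a1)"
    by (simp only: \<open>\<Xi> = _\<close> \<open>f = _\<close> \<open>g = _\<close> \<iota>_linear) (simp only: linear_poly_def)
  have not_scalar: "\<Xi> \<noteq> \<kappa> c" for c
    using assms(9) by (auto simp: \<kappa>_def h_def)
  have "h \<alpha> * \<Xi> \<noteq> \<Xi> * h \<alpha> \<and> freely_generates (\<lambda>c z. \<kappa> c * z) {h \<alpha> * \<Xi>, \<Xi> * h \<alpha>}"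
    using assms(14)
  proof
    assume "b1 = 0"
    then have \<Xi>': "\<Xi> = \<kappa> b0 * inverse (linear_poly a0 a1)"
      by (simp add: \<Xi> \<kappa>_zero)
    have "b0 \<noteq> 0"
      using not_scalar[of 0] \<Xi>' by (auto simp: \<kappa>_zero)
    from free_case_constant[OF \<open>a1 \<noteq> 0\<close> this indep disjoint \<Xi>'] show ?thesis .
  next
    assume "b0 = 0 \<and> \<delta> = (\<lambda>_. 0)"
    then have b0: "b0 = 0" and \<delta>: "\<delta> = (\<lambda>_. 0)" by blast+
    have \<Xi>': "\<Xi> = \<kappa> b1 * X * inverse (linear_poly a0 a1)"
      by (simp add: \<Xi> b0 \<kappa>_zero)
    have "b1 \<noteq> 0"
      using not_scalar[of 0] \<Xi>' by (auto simp: \<kappa>_zero)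
    \<comment> \<open>For \<open>a0 = 0\<close> the factor \<open>X\<close> cancels and
      \<open>\<Xi>\<close> becomes the scalar \<open>b1 / a1\<close>.\<close>
    have "a0 \<noteq> 0"
    proof
      assume "a0 = 0"
      then have "linear_poly a0 a1 = \<kappa> a1 * X"
        by (simp add: linear_poly_def \<kappa>_zero)
      then have "\<Xi> = \<kappa> b1 * X * (inverse X * \<kappa> (inverse a1))"
        using \<open>a1 \<noteq> 0\<close> X_nonzero \<Xi>' by (simp add: nonzero_inverse_mult_distrib \<kappa>_eq_0 inverse_\<kappa>)
      also have "\<dots> = \<kappa> (b1 * inverse a1)"
        using X_nonzero by (simp add: mult.assoc \<kappa>_mult[symmetric]) (simp flip: mult.assoc)
      finally show False
        using not_scalar by blast
    qed
    from free_case_X[OF this \<open>a1 \<noteq> 0\<close> \<open>b1 \<noteq> 0\<close> \<delta> indep disjoint \<Xi>'] show ?thesis .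
  qed
  then show ?thesis
    unfolding \<kappa>_def h_def .
qed

end
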